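(* Let $X,Y$ be metric spaces with $X$ complete, $F:X\times\mathbb{R}_+\rightrightarrows Y$ a set-valued mapping, $W\subset X\times Y$, and $\mu:[0,+\infty]\to[0,+\infty]$ an upper semicontinuous nondecreasing function. Then the following two properties are equivalent: (i) ($F$ is regular on $W$ with functional modulus $\mu$) $d(x,F_0^{-1}(y))\le\mu(\delta(y,F,x))$ for all $(x,y)\in W$; (ii) ($F$ is open on $W$ with functional modulus $\mu$) $y\in F(B(x,t),0)$ for all $(x,y)\in W$ and all (real) $t>\mu(\delta(y,F,x))$.
   Context: $\mathbb{R}_+=[0,\infty)$. $B(x,r)$ is the open ball. $d(x,C)=\inf_{c\in C}d(x,c)$, with $d(x,\emptyset)=+\infty$. Set-valued mappings have possibly empty values; $F_0^{-1}(y)=\{x\in X\mid y\in F(x,0)\}$, $F(A,0)=\bigcup_{z\in A}F(z,0)$, and $\delta(y,F,x):=\inf\{t>0\mid y\in F(x,t)\}$ (with $\inf\emptyset=+\infty$). *)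

theory Defs
  imports "HOL-Analysis.Analysis"
begin

text \<open>
  Values in \<open>[0, +\<infinity>]\<close> are of type \<^typ>\<open>ennreal\<close>, where the infimum of the empty set is \<open>\<top>\<close>.
  A set-valued mapping from \<open>X \<times> [0, \<infinity>)\<close> to \<open>Y\<close> is represented by a function
  \<open>F :: 'a \<Rightarrow> real \<Rightarrow> 'b set\<close>; its values at negative reals are never inspected.
\<close>

text \<open>
  The library's \<open>infdist\<close> is real-valued and is \<open>0\<close> at the empty set, so it is not suitable here.
\<close>

definition edist_set :: "'a::metric_space \<Rightarrow> 'a set \<Rightarrow> ennreal" where
  "edist_set x C = (INF c\<in>C. ennreal (dist x c))"

definition F0_inv :: "('a \<Rightarrow> real \<Rightarrow> 'b set) \<Rightarrow> 'b \<Rightarrow> 'a set" where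
  "F0_inv F y = {x. y \<in> F x 0}"

definition set_image :: "('a \<Rightarrow> real \<Rightarrow> 'b set) \<Rightarrow> 'a set \<Rightarrow> real \<Rightarrow> 'b set" where
  "set_image F A t = (\<Union>z\<in>A. F z t)"

definition delta :: "'b \<Rightarrow> ('a \<Rightarrow> real \<Rightarrow> 'b set) \<Rightarrow> 'a \<Rightarrow> ennreal" where
  "delta y F x = Inf {ennreal t | t. 0 < t \<and> y \<in> F x t}"

definition upper_semicontinuous :: "('a::topological_space \<Rightarrow> 'b::linorder) \<Rightarrow> bool" where
  "upper_semicontinuous f \<longleftrightarrow> (\<forall>x. \<forall>c. f x < c \<longrightarrow> (\<forall>\<^sub>F z in nhds x. f z < c))"

definition regular_on ::
  "('a::metric_space \<Rightarrow> real \<Rightarrow> 'b set) \<Rightarrow> ('a \<times> 'b) set \<Rightarrow> (ennreal \<Rightarrow> ennreal) \<Rightarrow> bool" where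
  "regular_on F W \<mu> \<longleftrightarrow> (\<forall>(x, y)\<in>W. edist_set x (F0_inv F y) \<le> \<mu> (delta y F x))"

definition open_map_on ::
  "('a::metric_space \<Rightarrow> real \<Rightarrow> 'b set) \<Rightarrow> ('a \<times> 'b) set \<Rightarrow> (ennreal \<Rightarrow> ennreal) \<Rightarrow> bool" where
  "open_map_on F W \<mu> \<longleftrightarrow>
     (\<forall>(x, y)\<in>W. \<forall>t::real. \<mu> (delta y F x) < ennreal t \<longrightarrow> y \<in> set_image F (ball x t) 0)"

end

theory Submission
  imports Defs
begin

text \<open>
  Both properties compare, at each \<open>(x, y) \<in> W\<close>, the distance from \<open>x\<close> to the solution set
  \<open>F0_inv F y\<close> with one and the same value \<open>m = \<mu> (delta y F x)\<close>. Since a distance is an infimum, a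
  strict bound \<open>edist_set x C < t\<close> means exactly that the open ball of radius \<open>t\<close> around \<open>x\<close>
  meets \<open>C\<close>; for \<open>C = F0_inv F y\<close> this is \<open>y \<in> set_image F (ball x t) 0\<close>. So openness says
  that every real \<open>t\<close> above \<open>m\<close> is also above the distance, which is the inequality of
  regularity, because the real numbers are dense in \<open>[0, \<infinity>]\<close>. If \<open>m = \<infinity>\<close>, both properties
  hold trivially at \<open>(x, y)\<close>.
\<close>

text \<open>
  The infimum defining the distance is below \<open>t\<close> exactly when one of its members is. The radii in
  \<open>open_map_on\<close> range over all reals; for \<open>t \<le> 0\<close> the embedding \<open>ennreal\<close> truncates \<open>t\<close> to \<open>0\<close>,
  and both sides are false.
\<close>

lemma edist_set_less_iff: "edist_set x C < ennreal t \<longleftrightarrow> (\<exists>c\<in>C. dist x c < t)"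
  by (simp add: edist_set_def INF_less_iff ennreal_less_iff)

lemma mem_set_image_ball_iff:
  "y \<in> set_image F (ball x t) 0 \<longleftrightarrow> edist_set x (F0_inv F y) < ennreal t"
  by (auto simp: edist_set_less_iff set_image_def F0_inv_def)

lemma ennreal_le_iff_real_less:
  fixes a m :: ennreal
  shows "a \<le> m \<longleftrightarrow> (\<forall>t::real. m < ennreal t \<longrightarrow> a < ennreal t)"
proof
  assume "a \<le> m"
  then show "\<forall>t::real. m < ennreal t \<longrightarrow> a < ennreal t"
    by (auto intro: le_less_trans)
next
  assume above: "\<forall>t::real. m < ennreal t \<longrightarrow> a < ennreal t"
  show "a \<le> m"
  proof (rule ccontr)
    assume "\<not> a \<le> m"
    then obtain z where z: "m < z" "z < a"
      using dense[of m a] by (auto simp: not_le)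
    \<comment> \<open>Lying strictly below \<open>a\<close>, the intermediate value \<open>z\<close> is finite even if \<open>a = \<infinity>\<close>.\<close>
    then obtain t where "z = ennreal t"
      by (cases z) auto
    with above z show False
      by auto
  qed
qed

theorem proposition3p2:
  fixes F :: "'a::complete_space \<Rightarrow> real \<Rightarrow> 'b::metric_space set"
    and W :: "('a \<times> 'b) set"
    and \<mu> :: "ennreal \<Rightarrow> ennreal"
  assumes "upper_semicontinuous \<mu>"
    and "mono \<mu>"
  shows "regular_on F W \<mu> \<longleftrightarrow> open_map_on F W \<mu>"
  unfolding regular_on_def open_map_on_def mem_set_image_ball_iff
  by (simp only: ennreal_le_iff_real_less[symmetric])

end
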